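(* Let $G$ be a $(P_5,\textit{HVN})$-free graph that contains an induced $T$-5-wheel. Then $\chi(G)\leq\omega(G)+3$.
   Context: Graphs are finite, simple and connected. $P_5$ is the path on 5 vertices; an HVN is a $K_4$ plus a vertex adjacent to exactly two vertices of the $K_4$; $(H_1,H_2)$-free means no induced $H_1$ or $H_2$. A $T$-5-wheel is a chordless 5-cycle $v_1v_2v_3v_4v_5v_1$ together with an additional vertex adjacent to exactly three consecutive vertices of the cycle (e.g. $v_5,v_1,v_2$). $\chi$ and $\omega$ denote chromatic and clique number. *)

theory Defs
  imports "Graph_Theory.Graph_Theory"
begin

text \<open>
  Finite simple undirected graphs are the symmetric, loop-free digraphs without parallel arcs of the
  locale \<^locale>\<open>graph\<close>; an undirected edge is a pair of opposite arcs.
\<close>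

definition graph_of_edges :: "nat \<Rightarrow> (nat \<times> nat) set \<Rightarrow> (nat, nat \<times> nat) pre_digraph" where
  "graph_of_edges n E = with_proj \<lparr>pverts = {..<n}, parcs = E \<union> E\<inverse>\<rparr>"

definition P5 :: "(nat, nat \<times> nat) pre_digraph" where
  "P5 = graph_of_edges 5 {(0,1), (1,2), (2,3), (3,4)}"

text \<open>The \<open>K\<^sub>4\<close> lives on \<open>0, \<dots>, 3\<close>; the additional vertex is \<open>4\<close>.\<close>

definition HVN :: "(nat, nat \<times> nat) pre_digraph" where
  "HVN = graph_of_edges 5
     ({(0,1), (0,2), (0,3), (1,2), (1,3), (2,3)} \<union> {(4,0), (4,1)})"

text \<open>
  The vertex \<open>v\<^sub>i\<close> of the 5-cycle is \<open>i - 1\<close>; the additional vertex \<open>5\<close> is adjacent to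
  \<open>v\<^sub>5\<close>, \<open>v\<^sub>1\<close>, \<open>v\<^sub>2\<close>.
\<close>

definition T_5_wheel :: "(nat, nat \<times> nat) pre_digraph" where
  "T_5_wheel = graph_of_edges 6
     ({(0,1), (1,2), (2,3), (3,4), (4,0)} \<union> {(5,4), (5,0), (5,1)})"

definition contains_induced :: "('a, 'b) pre_digraph \<Rightarrow> ('c, 'd) pre_digraph \<Rightarrow> bool" where
  "contains_induced G H \<longleftrightarrow> (\<exists>G'. induced_subgraph G' G \<and> digraph_iso H G')"

definition proper_colouring :: "('a, 'b) pre_digraph \<Rightarrow> nat \<Rightarrow> ('a \<Rightarrow> nat) \<Rightarrow> bool" where
  "proper_colouring G k c \<longleftrightarrow>
     (\<forall>v\<in>verts G. c v < k) \<and> (\<forall>u v. u \<rightarrow>\<^bsub>G\<^esub> v \<longrightarrow> c u \<noteq> c v)"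

definition chromatic_number :: "('a, 'b) pre_digraph \<Rightarrow> nat" where
  "chromatic_number G = (LEAST k. \<exists>c. proper_colouring G k c)"

definition is_clique :: "('a, 'b) pre_digraph \<Rightarrow> 'a set \<Rightarrow> bool" where
  "is_clique G S \<longleftrightarrow> S \<subseteq> verts G \<and> (\<forall>u\<in>S. \<forall>v\<in>S. u \<noteq> v \<longrightarrow> u \<rightarrow>\<^bsub>G\<^esub> v)"

definition clique_number :: "('a, 'b) pre_digraph \<Rightarrow> nat" where
  "clique_number G = Max (card ` {S. is_clique G S})"

end

(*
  In a graph without induced HVN every neighbourhood is paw-free, so by Olariu's theorem each of its
  components is triangle-free or complete multipartite; if there is also no induced P5, a triangle-free
  component is bipartite or a blow-up of C5. Hence every neighbourhood can be coloured with
  omega >= 3 colours.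

  Relative to a T-5-wheel v1, ..., v5, w the vertices fall into a few classes. The class K (seeing v1 and w,
  but not both of v2 and v5) is stable and gets a colour of its own. The vertices without a neighbour on
  the wheel form components that are homogeneous sets, each inside the neighbourhood of one vertex. If
  the stable class Z is nonempty, it takes a second colour, and the rest is N(v2) together with
  the vertices with trace {v3, v5}, which are stable up to reflecting the wheel. If Z is empty, the rest is
  N(v2) together with the vertices with trace {v3, v5} or {v3, v4, v5}; either both of these classes are stable,
  up to reflection, or the two traces of size three both occur and can share colours. Otherwise a K4
  straddling both sides would yield an HVN.
*)
theory Submission
  imports Defs
begin

subsection \<open>Graphs without induced \<open>P\<^sub>5\<close> and HVN\<close>

text \<open>The listed adjacencies and non-adjacencies already force the five vertices apart, so
  \<open>P5_free\<close> and \<open>HVN_free\<close> apply to arbitrary vertices without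
  distinctness side conditions.\<close>

locale P5_HVN_free =
  fixes V :: "'a set" and adj :: "'a \<Rightarrow> 'a \<Rightarrow> bool" (infix "\<sim>" 50)
  assumes finite_V: "finite V"
    and adj_in_V: "x \<sim> y \<Longrightarrow> x \<in> V"
    and adj_sym: "x \<sim> y \<Longrightarrow> y \<sim> x"
    and adj_irrefl [simp]: "\<not> x \<sim> x"
    and P5_free: "\<lbrakk>a \<sim> b; b \<sim> c; c \<sim> d; d \<sim> e; \<not> a \<sim> c; \<not> a \<sim> d; \<not> a \<sim> e; \<not> b \<sim> d; \<not> b \<sim> e; \<not> c \<sim> e\<rbrakk>
      \<Longrightarrow> False"
    and HVN_free: "\<lbrakk>a \<sim> b; a \<sim> c; a \<sim> d; b \<sim> c; b \<sim> d; c \<sim> d; e \<sim> a; e \<sim> b; \<not> e \<sim> c; \<not> e \<sim> d\<rbrakk>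
      \<Longrightarrow> False"
begin

lemma adj_commute: "x \<sim> y \<longleftrightarrow> y \<sim> x"
  using adj_sym by blast

lemma non_adj_sym: "\<not> x \<sim> y \<Longrightarrow> \<not> y \<sim> x"
  using adj_sym by blast

definition clique :: "'a set \<Rightarrow> bool" where
  "clique S \<longleftrightarrow> (\<forall>x\<in>S. \<forall>y\<in>S. x \<noteq> y \<longrightarrow> x \<sim> y)"

definition stable :: "'a set \<Rightarrow> bool" where
  "stable S \<longleftrightarrow> (\<forall>x\<in>S. \<forall>y\<in>S. \<not> x \<sim> y)"

definition colouring :: "'a set \<Rightarrow> nat set \<Rightarrow> ('a \<Rightarrow> nat) \<Rightarrow> bool" where
  "colouring S C c \<longleftrightarrow> c ` S \<subseteq> C \<and> (\<forall>x\<in>S. \<forall>y\<in>S. x \<sim> y \<longrightarrow> c x \<noteq> c y)"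

section \<open>Connected components, and colourings glued from them\<close>

definition links :: "'a set \<Rightarrow> ('a \<times> 'a) set" where
  "links S = {(x, y). x \<in> S \<and> y \<in> S \<and> x \<sim> y}\<^sup>*"

definition component :: "'a set \<Rightarrow> 'a \<Rightarrow> 'a set" where
  "component S x = links S `` {x}"

definition connected_set :: "'a set \<Rightarrow> bool" where
  "connected_set S \<longleftrightarrow> (\<forall>x\<in>S. \<forall>y\<in>S. (x, y) \<in> links S)"

lemma sym_links: "sym (links S)"
  unfolding links_def by (intro sym_rtrancl symI) (auto intro: adj_sym)

lemma component_self: "x \<in> component S x"
  by (simp add: component_def links_def)

lemma component_step:
  assumes "y \<in> component S x" "y \<in> S" "z \<in> S" "y \<sim> z"
  shows "z \<in> component S x"
  using assms by (auto simp: component_def links_def intro: rtrancl.rtrancl_into_rtrancl)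

lemma component_eq: "y \<in> component S x \<Longrightarrow> component S y = component S x"
  using sym_links[of S] unfolding component_def links_def sym_def
  by (auto intro: rtrancl_trans)

lemma component_subset: "x \<in> S \<Longrightarrow> component S x \<subseteq> S"
proof
  fix y assume "x \<in> S" "y \<in> component S x"
  then have "(x, y) \<in> {(x, y). x \<in> S \<and> y \<in> S \<and> x \<sim> y}\<^sup>*"
    by (simp add: component_def links_def)
  then show "y \<in> S" using \<open>x \<in> S\<close> by induction auto
qed

lemma connected_component:
  assumes "x \<in> S"
  shows "connected_set (component S x)"
proof -
  let ?Q = "component S x"
  have from_x: "(x, y) \<in> links ?Q" if "y \<in> ?Q" for y
  proof -
    have "(x, y) \<in> {(x, y). x \<in> S \<and> y \<in> S \<and> x \<sim> y}\<^sup>*"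
      using that by (simp add: component_def links_def)
    then have "y \<in> ?Q \<and> (x, y) \<in> links ?Q"
    proof induction
      case base
      then show ?case by (simp add: component_self links_def)
    next
      case (step y z)
      then have "z \<in> ?Q" using component_step by blast
      then show ?case using step unfolding links_def
        by (auto intro: rtrancl.rtrancl_into_rtrancl)
    qed
    then show ?thesis ..
  qed
  show ?thesis unfolding connected_set_def
  proof (intro ballI)
    fix y z assume "y \<in> ?Q" "z \<in> ?Q"
    then have "(y, x) \<in> links ?Q" "(x, z) \<in> links ?Q"
      using from_x sym_links[of ?Q] by (auto dest: symD)
    then show "(y, z) \<in> links ?Q" unfolding links_def by (rule rtrancl_trans)
  qed
qed

lemma connected_set_induct [consumes 3, case_names base step]:
  assumes "connected_set Q" "u \<in> Q" "x \<in> Q"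
    and base: "P u"
    and step: "\<And>x y. x \<in> Q \<Longrightarrow> y \<in> Q \<Longrightarrow> x \<sim> y \<Longrightarrow> P x \<Longrightarrow> P y"
  shows "P x"
proof -
  have "(u, x) \<in> {(x, y). x \<in> Q \<and> y \<in> Q \<and> x \<sim> y}\<^sup>*"
    using assms(1-3) by (auto simp: connected_set_def links_def)
  then show ?thesis by induction (use base step in auto)
qed

text \<open>No edge joins two components, so their colourings can be glued. \<open>T\<close> and
  \<open>D\<close> carry a side condition along: vertices of \<open>T\<close> take colours in
  \<open>D\<close>.\<close>

lemma colouring_by_components:
  assumes "\<And>x. x \<in> S \<Longrightarrow> \<exists>c. colouring (component S x) C c \<and> c ` (component S x \<inter> T) \<subseteq> D"
  shows "\<exists>c. colouring S C c \<and> c ` (S \<inter> T) \<subseteq> D"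
proof -
  have "\<exists>c. colouring Q C c \<and> c ` (Q \<inter> T) \<subseteq> D" if "Q \<in> component S ` S" for Q
    using assms that by auto
  then obtain f where f: "\<And>Q. Q \<in> component S ` S \<Longrightarrow>
      colouring Q C (f Q) \<and> f Q ` (Q \<inter> T) \<subseteq> D"
    by metis
  \<comment> \<open>\<open>f\<close> is indexed by the component and not by a vertex of it, so
    adjacent vertices are coloured by the same function.\<close>
  define c where "c x = f (component S x) x" for x
  have "colouring S C c"
    unfolding colouring_def
  proof (intro conjI ballI impI subsetI)
    fix n assume "n \<in> c ` S"
    then show "n \<in> C" using f component_self by (fastforce simp: c_def colouring_def)
  next
    fix x y assume xy: "x \<in> S" "y \<in> S" "x \<sim> y"
    then have y: "y \<in> component S x" using component_step component_self by blast
    then have "component S y = component S x" by (rule component_eq)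
    then show "c x \<noteq> c y"
      using f[of "component S x"] xy y component_self[of x S] by (auto simp: c_def colouring_def)
  qed
  moreover have "c ` (S \<inter> T) \<subseteq> D"
    using f component_self by (fastforce simp: c_def)
  ultimately show ?thesis by blast
qed

section \<open>Paw-free sets\<close>

definition paw_free :: "'a set \<Rightarrow> bool" where
  "paw_free Q \<longleftrightarrow> (\<forall>a\<in>Q. \<forall>b\<in>Q. \<forall>c\<in>Q. \<forall>d\<in>Q.
     a \<sim> b \<longrightarrow> b \<sim> c \<longrightarrow> a \<sim> c \<longrightarrow> d \<sim> a \<longrightarrow> d \<sim> b \<or> d \<sim> c)"

lemma paw_freeD:
  "paw_free Q \<Longrightarrow> a \<in> Q \<Longrightarrow> b \<in> Q \<Longrightarrow> c \<in> Q \<Longrightarrow> d \<in> Q \<Longrightarrow> a \<sim> b \<Longrightarrow> b \<sim> c \<Longrightarrow> a \<sim> c \<Longrightarrow> d \<sim> a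
    \<Longrightarrow> d \<sim> b \<or> d \<sim> c"
  by (auto simp: paw_free_def)

text \<open>A paw among the neighbours of \<open>z\<close> gives an HVN: \<open>z\<close>,
  \<open>a\<close>, \<open>b\<close>, \<open>c\<close> form the K4, and \<open>d\<close> sees
  exactly \<open>z\<close> and \<open>a\<close> of it.\<close>

lemma paw_free_neighbourhood:
  assumes "\<And>x. x \<in> Q \<Longrightarrow> z \<sim> x"
  shows "paw_free Q"
  unfolding paw_free_def
proof (intro ballI impI)
  fix a b c d
  assume "a \<in> Q" "b \<in> Q" "c \<in> Q" "d \<in> Q" "a \<sim> b" "b \<sim> c" "a \<sim> c" "d \<sim> a"
  then show "d \<sim> b \<or> d \<sim> c"
    using HVN_free[of z a b c d] assms[of a] assms[of b] assms[of c] assms[of d] adj_sym by blast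
qed

text \<open>This is Olariu's theorem.\<close>

lemma paw_free_multipartite:
  assumes conn: "connected_set Q" and paw: "paw_free Q"
    and tri: "a \<in> Q" "b \<in> Q" "c \<in> Q" "a \<sim> b" "b \<sim> c" "a \<sim> c"
    and xyz: "x \<in> Q" "y \<in> Q" "z \<in> Q" "x \<sim> y"
  shows "z \<sim> x \<or> z \<sim> y"
proof -
  \<comment> \<open>Lying in a triangle spreads along edges: a neighbour of a triangle vertex sees a
    second vertex of that triangle. The same argument then puts every edge of \<open>Q\<close> into
    a triangle.\<close>
  have in_triangle: "\<exists>s\<in>Q. \<exists>t\<in>Q. p \<sim> s \<and> s \<sim> t \<and> p \<sim> t" if "p \<in> Q" for p
    using conn \<open>a \<in> Q\<close> that
  proof (induction rule: connected_set_induct)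
    case base
    then show ?case using tri by blast
  next
    case (step p q)
    then obtain s t where st: "s \<in> Q" "t \<in> Q" "p \<sim> s" "s \<sim> t" "p \<sim> t" by blast
    then have "q \<sim> s \<or> q \<sim> t" using paw_freeD[OF paw, of p s t q] step adj_sym by blast
    then show ?case using st step adj_sym by blast
  qed
  have edge_in_triangle: "\<exists>t\<in>Q. p \<sim> t \<and> q \<sim> t" if pq: "p \<in> Q" "q \<in> Q" "p \<sim> q" for p q
  proof -
    obtain s t where st: "s \<in> Q" "t \<in> Q" "p \<sim> s" "s \<sim> t" "p \<sim> t"
      using in_triangle pq by blast
    then have "q \<sim> s \<or> q \<sim> t" using paw_freeD[OF paw, of p s t q] pq adj_sym by blast
    then show ?thesis using st by blast
  qed
  \<comment> \<open>Induction along a walk from \<open>x\<close> to \<open>z\<close>: seeing an end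
    of the edge \<open>x y\<close> passes from each vertex to the next.\<close>
  show ?thesis
    using conn \<open>x \<in> Q\<close> \<open>z \<in> Q\<close>
  proof (induction rule: connected_set_induct)
    case base
    then show ?case using xyz by simp
  next
    case (step p q)
    show ?case
    proof (rule ccontr)
      assume neg: "\<not> (q \<sim> x \<or> q \<sim> y)"
      have no: False if st: "s \<in> Q" "t \<in> Q" "s \<sim> t" "p \<sim> s" "\<not> q \<sim> s" "\<not> q \<sim> t" for s t
      proof (cases "p \<sim> t")
        case True
        then show False
          using paw_freeD[OF paw, of p s t q] st step.hyps adj_sym by blast
      next
        case False
        \<comment> \<open>Paw-freeness is used three times: \<open>p\<close> sees the common
          neighbour \<open>r\<close>, hence so does \<open>q\<close>, hence \<open>q\<close> sees
          \<open>s\<close> or \<open>t\<close>.\<close>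
        obtain r where r: "r \<in> Q" "s \<sim> r" "t \<sim> r" using edge_in_triangle[of s t] st by blast
        then have "p \<sim> r"
          using paw_freeD[OF paw, of s t r p] st step.hyps False by blast
        then have "q \<sim> r"
          using paw_freeD[OF paw, of p s r q] st step.hyps r adj_sym by blast
        then show False
          using paw_freeD[OF paw, of r s t q] st step.hyps r adj_sym by blast
      qed
      show False
        using step.IH neg no[of x y] no[of y x] xyz adj_sym by blast
    qed
  qed
qed

section \<open>Connected triangle-free sets: blow-ups of C5 and bipartite graphs\<close>

definition induced_C5 :: "'a \<Rightarrow> 'a \<Rightarrow> 'a \<Rightarrow> 'a \<Rightarrow> 'a \<Rightarrow> bool" where
  "induced_C5 a b c d e \<longleftrightarrow> a \<sim> b \<and> b \<sim> c \<and> c \<sim> d \<and> d \<sim> e \<and> e \<sim> a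
     \<and> \<not> a \<sim> c \<and> \<not> a \<sim> d \<and> \<not> b \<sim> d \<and> \<not> b \<sim> e \<and> \<not> c \<sim> e"

definition triangle_free :: "'a set \<Rightarrow> bool" where
  "triangle_free Q \<longleftrightarrow> (\<forall>a\<in>Q. \<forall>b\<in>Q. \<forall>c\<in>Q. \<not> (a \<sim> b \<and> b \<sim> c \<and> a \<sim> c))"

lemma triangle_freeD:
  "triangle_free Q \<Longrightarrow> a \<in> Q \<Longrightarrow> b \<in> Q \<Longrightarrow> c \<in> Q \<Longrightarrow> a \<sim> b \<Longrightarrow> b \<sim> c \<Longrightarrow> \<not> a \<sim> c"
  unfolding triangle_free_def by blast

lemma induced_C5_rotate: "induced_C5 a b c d e \<Longrightarrow> induced_C5 b c d e a"
  unfolding induced_C5_def using adj_sym by blast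

text \<open>If \<open>x\<close> missed both \<open>c\<close> and \<open>d\<close>, then
  \<open>x a b c d\<close> would be an induced P5. Seeing just one of them makes \<open>x\<close> a
  twin of \<open>b\<close> or of \<open>e\<close>.\<close>

lemma C5_neighbour:
  assumes "induced_C5 a b c d e" "x \<sim> a" "\<not> x \<sim> b" "\<not> x \<sim> e" "\<not> (x \<sim> c \<and> x \<sim> d)"
  shows "induced_C5 x c d e a \<or> induced_C5 x a b c d"
  using assms P5_free[of x a b c d] unfolding induced_C5_def by (simp add: adj_commute) argo

text \<open>Otherwise \<open>y x b c d\<close> is an induced P5. Applied to a twin \<open>x\<close>
  of a cycle vertex, this shows that neighbours of twins see the cycle.\<close>

lemma C5_second_neighbour:
  assumes "induced_C5 x b c d e" "x \<sim> y"
  shows "y \<sim> b \<or> y \<sim> c \<or> y \<sim> d"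
  using assms P5_free[of y x b c d] unfolding induced_C5_def by (simp add: adj_commute) argo

text \<open>A vertex seeing the cycle is a twin of a cycle vertex, as triangles are excluded; a
  neighbour of a twin sees the cycle again. So being a twin spreads over the connected set
  \<open>Q\<close>, which is thus a blow-up of the cycle.\<close>

lemma C5_dominates:
  assumes conn: "connected_set Q" and tri: "triangle_free Q"
    and C: "induced_C5 a b c d e" "{a, b, c, d, e} \<subseteq> Q" and x: "x \<in> Q"
  shows "induced_C5 x b c d e \<or> induced_C5 x c d e a \<or> induced_C5 x d e a b
    \<or> induced_C5 x e a b c \<or> induced_C5 x a b c d"
proof -
  let ?attached = "\<lambda>x. induced_C5 x b c d e \<or> induced_C5 x c d e a \<or> induced_C5 x d e a b
    \<or> induced_C5 x e a b c \<or> induced_C5 x a b c d"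
  note C' = C(1) induced_C5_rotate[OF C(1)] induced_C5_rotate[OF induced_C5_rotate[OF C(1)]]
    induced_C5_rotate[OF induced_C5_rotate[OF induced_C5_rotate[OF C(1)]]]
    induced_C5_rotate[OF induced_C5_rotate[OF induced_C5_rotate[OF induced_C5_rotate[OF C(1)]]]]
  have edges: "a \<sim> b" "b \<sim> c" "c \<sim> d" "d \<sim> e" "e \<sim> a"
    using C by (auto simp: induced_C5_def)
  have one: "?attached x" if x: "x \<in> Q" and adj: "x \<sim> a \<or> x \<sim> b \<or> x \<sim> c \<or> x \<sim> d \<or> x \<sim> e" for x
  proof -
    have no: "\<not> (x \<sim> a \<and> x \<sim> b)" "\<not> (x \<sim> b \<and> x \<sim> c)" "\<not> (x \<sim> c \<and> x \<sim> d)"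
      "\<not> (x \<sim> d \<and> x \<sim> e)" "\<not> (x \<sim> e \<and> x \<sim> a)"
      using triangle_freeD[OF tri x] C(2) edges by blast+
    show ?thesis
      using adj no C5_neighbour[OF C'(1), of x] C5_neighbour[OF C'(2), of x]
        C5_neighbour[OF C'(3), of x] C5_neighbour[OF C'(4), of x] C5_neighbour[OF C'(5), of x]
      by argo
  qed
  have far: "y \<sim> a \<or> y \<sim> b \<or> y \<sim> c \<or> y \<sim> d \<or> y \<sim> e" if "?attached x" "x \<sim> y" for x y
    using that C5_second_neighbour by blast
  have "a \<in> Q" using C by simp
  from conn this x show ?thesis
  proof (induction rule: connected_set_induct)
    case base
    show ?case using C by simp
  next
    case (step x y)
    show ?case by (rule one[OF step.hyps(2) far[OF step.IH step.hyps(3)]])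
  qed
qed

text \<open>The colour is the parity of the distance from \<open>u\<close>, which is at most 3 by
  P5-freeness; \<open>near\<close> stands for distance 0 or 2.\<close>

lemma C5_free_bipartite:
  assumes conn: "connected_set Q" and tri: "triangle_free Q" and u: "u \<in> Q"
    and no_C5: "\<And>a b c d e. {a, b, c, d, e} \<subseteq> Q \<Longrightarrow> \<not> induced_C5 a b c d e"
    and "p \<noteq> q"
  shows "\<exists>c. colouring Q {p, q} c"
proof -
  define near where "near x \<longleftrightarrow> x = u \<or> (\<exists>a\<in>Q. u \<sim> a \<and> a \<sim> x)" for x
  define dist3 where "dist3 x \<longleftrightarrow> (\<exists>a\<in>Q. \<exists>b\<in>Q. u \<sim> a \<and> a \<sim> b \<and> b \<sim> x)" for x
  have reach: "near x \<or> u \<sim> x \<or> dist3 x" if "x \<in> Q" for x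
    using conn u that
  proof (induction rule: connected_set_induct)
    case base
    show ?case by (simp add: near_def)
  next
    case (step x y)
    show ?case
    proof (cases "near x \<or> u \<sim> x")
      case True
      then show ?thesis using step.hyps unfolding near_def dist3_def by blast
    next
      case False
      then obtain a b where ab: "a \<in> Q" "b \<in> Q" "u \<sim> a" "a \<sim> b" "b \<sim> x"
        using step.IH unfolding dist3_def by blast
      have "u \<sim> y \<or> a \<sim> y \<or> b \<sim> y"
        using P5_free[of u a b x y] ab step.hyps False unfolding near_def by blast
      then show ?thesis using ab unfolding near_def dist3_def by blast
    qed
  qed
  have near_near: False if xy: "x \<in> Q" "y \<in> Q" "x \<sim> y" "near x" "near y" for x y
  proof (cases "x = u \<or> y = u")
    case True
    have no: "\<not> u \<sim> z" if "z \<in> Q" "near z" for z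
      using that triangle_freeD[OF tri u] adj_irrefl unfolding near_def by blast
    show False using True no[of x] no[of y] xy adj_sym by blast
  next
    case False
    then obtain a b where ab: "a \<in> Q" "b \<in> Q" "u \<sim> a" "a \<sim> x" "u \<sim> b" "b \<sim> y"
      using xy unfolding near_def by blast
    \<comment> \<open>An edge between two vertices at distance 2 from \<open>u\<close> closes to an
      induced C5.\<close>
    have "induced_C5 u a x y b"
      unfolding induced_C5_def
      using ab xy u adj_sym triangle_freeD[OF tri] by meson
    then show False using no_C5[of u a x y b] ab xy u by simp
  qed
  have far_far: False if xy: "x \<in> Q" "y \<in> Q" "x \<sim> y" "\<not> near x" "\<not> near y" for x y
  proof -
    have nu: "\<not> u \<sim> x" "\<not> u \<sim> y" using xy adj_sym unfolding near_def by blast+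
    then obtain a b where ab: "a \<in> Q" "b \<in> Q" "u \<sim> a" "a \<sim> b" "b \<sim> x"
      using reach[of x] xy unfolding dist3_def by blast
    have "\<not> b \<sim> y" using triangle_freeD[OF tri, of b x y] ab xy by blast
    then show False
      using P5_free[of u a b x y] ab xy nu unfolding near_def by blast
  qed
  have "colouring Q {p, q} (\<lambda>x. if near x then p else q)"
    unfolding colouring_def using near_near far_far \<open>p \<noteq> q\<close> by auto
  then show ?thesis by blast
qed

text \<open>In the blow-up, the twins of \<open>b\<close> and \<open>e\<close> are the neighbours of
  \<open>u\<close> and take \<open>p\<close>, the twins of \<open>u\<close> take \<open>q\<close>,
  and the twins of \<open>c\<close> (\<open>left\<close>) and of \<open>d\<close>
  (\<open>right\<close>) take \<open>q\<close> and \<open>r\<close> in an order that suits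
  \<open>J\<close>.\<close>

lemma C5_colouring:
  assumes conn: "connected_set Q" and tri: "triangle_free Q"
    and C5: "induced_C5 u b c d e" "{u, b, c, d, e} \<subseteq> Q"
    and col: "p \<in> C" "q \<in> C" "r \<in> C" "p \<noteq> q" "p \<noteq> r" "q \<noteq> r"
    and I: "\<And>x. x \<in> I \<Longrightarrow> x \<sim> u" and J: "stable J" "\<And>x. x \<in> J \<Longrightarrow> \<not> x \<sim> u"
  shows "\<exists>f. colouring Q C f \<and> f ` (Q \<inter> (I \<union> J)) \<subseteq> {p, q}"
proof -
  define left where "left x \<longleftrightarrow> \<not> x \<sim> u \<and> x \<sim> b \<and> \<not> x \<sim> e" for x
  define right where "right x \<longleftrightarrow> \<not> x \<sim> u \<and> x \<sim> e \<and> \<not> x \<sim> b" for x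
  define twin where "twin x \<longleftrightarrow> \<not> x \<sim> u \<and> x \<sim> b \<and> x \<sim> e" for x
  have cases4: "x \<sim> u \<or> twin x \<or> left x \<or> right x" if "x \<in> Q" for x
    using C5_dominates[OF conn tri C5 that]
    unfolding left_def right_def twin_def induced_C5_def by (simp add: adj_commute) argo
  have left_right: "x \<sim> y" if "left x" "right y" for x y
    using P5_free[of x b u e y] C5 that
    unfolding left_def right_def induced_C5_def by (simp add: adj_commute) argo
  \<comment> \<open>\<open>left\<close> and \<open>right\<close> are completely joined, so the
    stable set \<open>J\<close> meets at most one of them; \<open>s\<close> hands \<open>q\<close>
    to that side.\<close>
  define s where "s \<longleftrightarrow> (\<exists>j\<in>J. right j)"
  define f where "f x = (if x \<sim> u then p else if twin x then q
    else if left x then (if s then r else q) else (if s then q else r))" for x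
  have no_edge: "\<not> (x \<sim> y \<and> x \<sim> z \<and> y \<sim> z)" if "x \<in> Q" "y \<in> Q" "z \<in> {u, b, c, d, e}" for x y z
    using triangle_freeD[OF tri, of x y z] that C5(2) by blast
  have "colouring Q C f"
    unfolding colouring_def
  proof (intro conjI ballI impI)
    show "f ` Q \<subseteq> C" using col by (auto simp: f_def)
    fix x y assume xy: "x \<in> Q" "y \<in> Q" "x \<sim> y"
    show "f x \<noteq> f y"
      using cases4[OF xy(1)] cases4[OF xy(2)] xy(3) col(4-6)
        no_edge[OF xy(1,2), of u] no_edge[OF xy(1,2), of b] no_edge[OF xy(1,2), of e]
      unfolding f_def left_def right_def twin_def by (simp split: if_splits) argo
  qed
  moreover have "f x \<in> {p, q}" if "x \<in> Q" "x \<in> I \<union> J" for x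
  proof (cases "x \<in> I")
    case True
    then show ?thesis using I by (simp add: f_def)
  next
    case False
    then have x: "x \<in> J" using that by simp
    then have "\<not> (s \<and> left x)"
      using left_right J(1) unfolding s_def stable_def by blast
    moreover have "right x \<Longrightarrow> s" using x by (auto simp: s_def)
    ultimately show ?thesis
      using cases4[OF that(1)] by (auto simp: f_def left_def right_def)
  qed
  ultimately show ?thesis by blast
qed

section \<open>Colouring a neighbourhood with two prescribed colours on part of it\<close>

lemma multipartite_colouring:
  assumes Q: "Q \<subseteq> V" and mp: "\<And>x y z. x \<in> Q \<Longrightarrow> y \<in> Q \<Longrightarrow> z \<in> Q \<Longrightarrow> x \<sim> y \<Longrightarrow> z \<sim> x \<or> z \<sim> y"
    and C: "finite C" and cliques: "\<And>S. S \<subseteq> Q \<Longrightarrow> clique S \<Longrightarrow> card S \<le> card C"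
    and pq: "p \<in> C" "q \<in> C" "p \<noteq> q" and ut: "u \<in> Q" "t \<in> Q" "u \<sim> t"
  shows "\<exists>c. colouring Q C c \<and> (\<forall>x\<in>Q. \<not> x \<sim> t \<longrightarrow> c x = p) \<and> (\<forall>x\<in>Q. \<not> x \<sim> u \<longrightarrow> c x = q)"
proof -
  \<comment> \<open>Non-adjacency is an equivalence relation on \<open>Q\<close>, and these are its
    classes.\<close>
  define part where "part x = {y \<in> Q. \<not> x \<sim> y}" for x
  have non_adj: "\<not> x \<sim> z" if "x \<in> Q" "y \<in> Q" "z \<in> Q" "\<not> x \<sim> y" "\<not> y \<sim> z" for x y z
    using mp[of x z y] that adj_sym by blast
  have part_eq: "part x = part y \<longleftrightarrow> \<not> x \<sim> y" if "x \<in> Q" "y \<in> Q" for x y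
  proof
    assume "part x = part y"
    moreover have "y \<in> part y" using that by (simp add: part_def)
    ultimately have "y \<in> part x" by simp
    then show "\<not> x \<sim> y" by (simp add: part_def)
  next
    assume xy: "\<not> x \<sim> y"
    then have yx: "\<not> y \<sim> x" by (rule non_adj_sym)
    show "part x = part y"
      unfolding part_def using non_adj[OF that _ xy] non_adj[OF that(2,1) _ yx] by blast
  qed
  define P where "P = part ` Q"
  have finQ: "finite Q" using Q finite_V by (rule finite_subset)
  have "\<forall>A\<in>P. \<exists>x. x \<in> Q \<and> part x = A" by (auto simp: P_def)
  \<comment> \<open>One representative per part: they form a clique, so there are at most
    \<open>card C\<close> parts.\<close>
  from bchoice[OF this] obtain h where h: "\<forall>A\<in>P. h A \<in> Q \<and> part (h A) = A" ..
  have "inj_on h P" by (rule inj_onI) (metis h)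
  then have "card P = card (h ` P)" by (simp add: card_image)
  also have "\<dots> \<le> card C"
  proof (rule cliques)
    show "h ` P \<subseteq> Q" using h by blast
    show "clique (h ` P)"
      unfolding clique_def
    proof (intro ballI impI)
      fix x y assume "x \<in> h ` P" "y \<in> h ` P" "x \<noteq> y"
      then obtain A B where "A \<in> P" "B \<in> P" "x = h A" "y = h B" "A \<noteq> B" by blast
      then show "x \<sim> y" using h part_eq[of x y] by simp
    qed
  qed
  finally have le: "card P \<le> card C" .
  have ne: "part u \<noteq> part t" using part_eq ut by blast
  have "card (P - {part u, part t}) \<le> card (C - {p, q})"
    using le ne ut pq finQ C by (simp add: P_def card_Diff_subset)
  then obtain g where g: "g ` (P - {part u, part t}) \<subseteq> C - {p, q}" "inj_on g (P - {part u, part t})"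
    using card_le_inj[of "P - {part u, part t}" "C - {p, q}"] finQ C by (auto simp: P_def)
  \<comment> \<open>The adjacent vertices \<open>u\<close> and \<open>t\<close> fix the colours of
    two different parts; the others share out the remaining colours injectively.\<close>
  define c where "c x = (if part x = part u then q else if part x = part t then p else g (part x))" for x
  have g_in: "g (part x) \<in> C - {p, q}" if "x \<in> Q" "part x \<noteq> part u" "part x \<noteq> part t" for x
    using g(1) that by (auto simp: P_def)
  have "colouring Q C c"
    unfolding colouring_def
  proof (intro conjI ballI impI)
    show "c ` Q \<subseteq> C" using pq g_in by (auto simp: c_def)
    fix x y assume xy: "x \<in> Q" "y \<in> Q" "x \<sim> y"
    then have "part x \<noteq> part y" using part_eq by blast
    moreover have "g (part x) \<noteq> g (part y)"
      if "part x \<notin> {part u, part t}" "part y \<notin> {part u, part t}"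
      using inj_onD[OF g(2), of "part x" "part y"] \<open>part x \<noteq> part y\<close> xy that by (auto simp: P_def)
    ultimately show "c x \<noteq> c y"
      using g_in[OF xy(1)] g_in[OF xy(2)] pq by (auto simp: c_def)
  qed
  moreover have "c x = p" if "x \<in> Q" "\<not> x \<sim> t" for x
  proof -
    have "part x = part t" using part_eq ut that by blast
    then show ?thesis using ne by (simp add: c_def)
  qed
  moreover have "c x = q" if "x \<in> Q" "\<not> x \<sim> u" for x
    using part_eq[OF that(1) ut(1)] that(2) by (simp add: c_def)
  ultimately show ?thesis by blast
qed

text \<open>Without triangles and C5, \<open>p\<close> and \<open>q\<close> colour all of
  \<open>Q\<close>; a blow-up of C5 needs one more colour, away from \<open>I\<close> and
  \<open>J\<close>. In the multipartite case \<open>J\<close> lies in the part of \<open>u\<close>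
  and the stable set \<open>I\<close> in a single other part.\<close>

lemma connected_paw_free_colouring:
  assumes conn: "connected_set Q" and paw: "paw_free Q" and Q: "Q \<subseteq> V"
    and C: "finite C" "3 \<le> card C" and cliques: "\<And>S. S \<subseteq> Q \<Longrightarrow> clique S \<Longrightarrow> card S \<le> card C"
    and pq: "p \<in> C" "q \<in> C" "p \<noteq> q" and u: "u \<in> Q"
    and I: "stable I" "\<And>x. x \<in> I \<Longrightarrow> x \<sim> u" and J: "stable J" "\<And>x. x \<in> J \<Longrightarrow> \<not> x \<sim> u"
  shows "\<exists>c. colouring Q C c \<and> c ` (Q \<inter> (I \<union> J)) \<subseteq> {p, q}"
proof (cases "triangle_free Q")
  case tri: True
  show ?thesis
  proof (cases "\<exists>a b c d e. {a, b, c, d, e} \<subseteq> Q \<and> induced_C5 a b c d e")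
    case True
    then obtain a b c d e where "{a, b, c, d, e} \<subseteq> Q" "induced_C5 a b c d e" by blast
    \<comment> \<open>By domination, \<open>u\<close> can replace some vertex of the cycle.\<close>
    then have "\<exists>b c d e. induced_C5 u b c d e \<and> {u, b, c, d, e} \<subseteq> Q"
      using C5_dominates[OF conn tri _ _ u, of a b c d e] u by (metis insert_subset)
    then obtain b c d e where C5: "induced_C5 u b c d e" "{u, b, c, d, e} \<subseteq> Q" by blast
    have "card (C - {p, q}) > 0" using C pq by (simp add: card_Diff_subset)
    then have "C - {p, q} \<noteq> {}" by force
    then obtain r where "r \<in> C" "p \<noteq> r" "q \<noteq> r" by blast
    then show ?thesis using C5_colouring[OF conn tri C5 pq(1,2) _ pq(3) _ _ I(2) J] by blast
  next
    case False
    then obtain c where "colouring Q {p, q} c"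
      using C5_free_bipartite[OF conn tri u _ pq(3)] by metis
    then show ?thesis using pq unfolding colouring_def by blast
  qed
next
  case False
  then obtain a b c where "a \<in> Q" "b \<in> Q" "c \<in> Q" "a \<sim> b" "b \<sim> c" "a \<sim> c"
    by (auto simp: triangle_free_def)
  note mp = paw_free_multipartite[OF conn paw this]
  \<comment> \<open>The part of \<open>t\<close> has to contain \<open>I\<close> within
    \<open>Q\<close>: a vertex of \<open>I\<close> serves, or any neighbour of \<open>u\<close> if
    \<open>I\<close> misses \<open>Q\<close>.\<close>
  obtain t where t: "t \<in> Q" "u \<sim> t" "\<And>x. x \<in> I \<inter> Q \<Longrightarrow> \<not> x \<sim> t"
  proof (cases "I \<inter> Q = {}")
    case True
    have "u \<sim> a \<or> u \<sim> b" using mp[of a b u] \<open>a \<in> Q\<close> \<open>b \<in> Q\<close> u \<open>a \<sim> b\<close> by blast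
    then show ?thesis using that True \<open>a \<in> Q\<close> \<open>b \<in> Q\<close> by blast
  next
    case False
    then show ?thesis using that I adj_sym unfolding stable_def by blast
  qed
  obtain c where c: "colouring Q C c" "\<And>x. x \<in> Q \<Longrightarrow> \<not> x \<sim> t \<Longrightarrow> c x = p"
    "\<And>x. x \<in> Q \<Longrightarrow> \<not> x \<sim> u \<Longrightarrow> c x = q"
    using multipartite_colouring[OF Q mp C(1) cliques pq u t(1,2)] by blast
  then have "c ` (Q \<inter> (I \<union> J)) \<subseteq> {p, q}" using t(3) J(2) by blast
  then show ?thesis using c(1) by blast
qed

lemma stable_empty: "stable {}"
  by (simp add: stable_def)

text \<open>Only the component of \<open>t\<close> can meet \<open>I\<close>, whose vertices all see
  \<open>t\<close>. In another component that meets \<open>J\<close>, a vertex of \<open>J\<close>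
  takes the place of \<open>t\<close>, as \<open>J\<close> is stable.\<close>

lemma neighbourhood_colouring_two_coloured:
  assumes H: "\<And>x. x \<in> H \<Longrightarrow> z \<sim> x"
    and C: "finite C" "3 \<le> card C" and cliques: "\<And>S. S \<subseteq> V \<Longrightarrow> clique S \<Longrightarrow> card S \<le> card C"
    and pq: "p \<in> C" "q \<in> C" "p \<noteq> q" and t: "t \<in> H"
    and I: "stable I" "\<And>x. x \<in> I \<Longrightarrow> x \<sim> t" and J: "stable J" "\<And>x. x \<in> J \<Longrightarrow> \<not> x \<sim> t"
  shows "\<exists>c. colouring H C c \<and> c ` (H \<inter> (I \<union> J)) \<subseteq> {p, q}"
proof (rule colouring_by_components)
  fix x assume x: "x \<in> H"
  let ?Q = "component H x"
  have QH: "?Q \<subseteq> H" using component_subset x .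
  then have Q: "?Q \<subseteq> V" using H adj_in_V adj_sym by blast
  have paw: "paw_free ?Q" using paw_free_neighbourhood[of ?Q z] QH H by blast
  have cl: "\<And>S. S \<subseteq> ?Q \<Longrightarrow> clique S \<Longrightarrow> card S \<le> card C" using cliques Q by blast
  have colour: "\<exists>c. colouring ?Q C c \<and> c ` (?Q \<inter> (I \<union> J)) \<subseteq> {p, q}"
    if "u \<in> ?Q" "stable I" "\<And>x. x \<in> I \<Longrightarrow> x \<sim> u" "stable J" "\<And>x. x \<in> J \<Longrightarrow> \<not> x \<sim> u" for u I J
    by (rule connected_paw_free_colouring[OF connected_component[OF x] paw Q C _ pq that]) (rule cl)
  show "\<exists>c. colouring ?Q C c \<and> c ` (?Q \<inter> (I \<union> J)) \<subseteq> {p, q}"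
  proof (cases "t \<in> ?Q")
    case True
    show ?thesis by (rule colour[OF True I J])
  next
    case False
    have I0: "?Q \<inter> I = {}"
    proof (rule ccontr)
      assume "?Q \<inter> I \<noteq> {}"
      then obtain y where y: "y \<in> ?Q" "y \<in> I" by blast
      then show False using component_step[OF y(1) _ t] QH I(2) False by blast
    qed
    show ?thesis
    proof (cases "?Q \<inter> J = {}")
      case True
      have "\<exists>c. colouring ?Q C c \<and> c ` (?Q \<inter> ({} \<union> {})) \<subseteq> {p, q}"
        by (rule colour[OF component_self stable_empty _ stable_empty]) simp_all
      then show ?thesis using True I0 by (simp add: Int_Un_distrib)
    next
      case False
      then obtain y where y: "y \<in> ?Q" "y \<in> J" by blast
      then have "\<And>x. x \<in> J \<Longrightarrow> \<not> x \<sim> y" using J(1) unfolding stable_def by blast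
      then have "\<exists>c. colouring ?Q C c \<and> c ` (?Q \<inter> ({} \<union> J)) \<subseteq> {p, q}"
        using colour[OF y(1) stable_empty _ J(1)] by simp
      then show ?thesis using I0 by (simp add: Int_Un_distrib)
    qed
  qed
qed

lemma neighbourhood_colouring:
  assumes H: "\<And>x. x \<in> H \<Longrightarrow> z \<sim> x"
    and C: "finite C" "3 \<le> card C" and cliques: "\<And>S. S \<subseteq> V \<Longrightarrow> clique S \<Longrightarrow> card S \<le> card C"
  shows "\<exists>c. colouring H C c"
proof (cases "H = {}")
  case True
  then show ?thesis by (simp add: colouring_def)
next
  case False
  then obtain t where t: "t \<in> H" by blast
  have "\<not> card C \<le> Suc 0" using C by simp
  then obtain p q where "p \<in> C" "q \<in> C" "p \<noteq> q"
    using C(1) by (metis card_le_Suc0_iff_eq)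
  then show ?thesis
    using neighbourhood_colouring_two_coloured[where I = "{}" and J = "{}", OF H C cliques _ _ _ t]
      stable_empty by blast
qed

end

subsection \<open>The classes of vertices around a T-5-wheel\<close>

locale T5_wheel = P5_HVN_free +
  fixes v1 v2 v3 v4 v5 w :: 'a
  assumes wheel_edges: "v1 \<sim> v2" "v2 \<sim> v3" "v3 \<sim> v4" "v4 \<sim> v5" "v5 \<sim> v1"
      "w \<sim> v5" "w \<sim> v1" "w \<sim> v2"
    and wheel_non_edges: "\<not> v1 \<sim> v3" "\<not> v1 \<sim> v4" "\<not> v2 \<sim> v4" "\<not> v2 \<sim> v5" "\<not> v3 \<sim> v5"
      "\<not> w \<sim> v3" "\<not> w \<sim> v4"
begin

lemmas wheel_adj [simp] = wheel_edges wheel_edges[THEN adj_sym]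
  wheel_non_edges wheel_non_edges[THEN non_adj_sym]

text \<open>
  Vertices are classified by their neighbours on the wheel. Of the possible neighbourhoods, \<open>K\<close>
  collects \<open>13w, 14w, 134w\<close>, \<open>Z\<close> collects \<open>1234, 1345, 12345, 234w, 345w, 2345w\<close>, \<open>X\<close> collects
  \<open>235, 245, 2345\<close> and \<open>R\<close> collects \<open>25, 125, 25w, 125w\<close>; the wheel vertices themselves are covered too.
  The reflection that swaps \<open>v\<^sub>2\<close> with \<open>v\<^sub>5\<close> and \<open>v\<^sub>3\<close> with \<open>v\<^sub>4\<close> fixes \<open>K\<close>, \<open>Z\<close>, \<open>X\<close> and \<open>R\<close>.
\<close>

definition far :: "'a \<Rightarrow> bool" where
  "far x \<longleftrightarrow> \<not> x \<sim> v1 \<and> \<not> x \<sim> v2 \<and> \<not> x \<sim> v3 \<and> \<not> x \<sim> v4 \<and> \<not> x \<sim> v5 \<and> \<not> x \<sim> w"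

definition K :: "'a \<Rightarrow> bool" where
  "K x \<longleftrightarrow> x \<sim> v1 \<and> x \<sim> w \<and> \<not> (x \<sim> v2 \<and> x \<sim> v5)"

definition Z :: "'a \<Rightarrow> bool" where
  "Z x \<longleftrightarrow> x \<sim> v3 \<and> x \<sim> v4 \<and> (x \<sim> v1) \<noteq> (x \<sim> w)"

definition X :: "'a \<Rightarrow> bool" where
  "X x \<longleftrightarrow> x \<sim> v2 \<and> x \<sim> v5 \<and> (x \<sim> v3 \<or> x \<sim> v4) \<and> \<not> x \<sim> v1 \<and> \<not> x \<sim> w"

definition R :: "'a \<Rightarrow> bool" where
  "R x \<longleftrightarrow> x \<sim> v2 \<and> x \<sim> v5 \<and> \<not> x \<sim> v3 \<and> \<not> x \<sim> v4"

definition A3 :: "'a \<Rightarrow> bool" where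
  "A3 x \<longleftrightarrow> x \<sim> v2 \<and> x \<sim> v4 \<and> \<not> x \<sim> v1 \<and> \<not> x \<sim> v3 \<and> \<not> x \<sim> v5 \<and> \<not> x \<sim> w"

definition A4 :: "'a \<Rightarrow> bool" where
  "A4 x \<longleftrightarrow> x \<sim> v5 \<and> x \<sim> v3 \<and> \<not> x \<sim> v1 \<and> \<not> x \<sim> v4 \<and> \<not> x \<sim> v2 \<and> \<not> x \<sim> w"

definition B3 :: "'a \<Rightarrow> bool" where
  "B3 x \<longleftrightarrow> x \<sim> v2 \<and> x \<sim> v3 \<and> x \<sim> v4 \<and> \<not> x \<sim> v1 \<and> \<not> x \<sim> v5 \<and> \<not> x \<sim> w"

definition B4 :: "'a \<Rightarrow> bool" where
  "B4 x \<longleftrightarrow> x \<sim> v5 \<and> x \<sim> v4 \<and> x \<sim> v3 \<and> \<not> x \<sim> v1 \<and> \<not> x \<sim> v2 \<and> \<not> x \<sim> w"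

lemmas class_defs = far_def K_def Z_def X_def R_def A3_def A4_def B3_def B4_def

section \<open>Stability of the classes and adjacency between them\<close>

lemma mirror: "T5_wheel V adj v1 v5 v4 v3 v2 w"
  by unfold_locales (simp_all)

text \<open>With any other trace, \<open>x\<close> and four wheel vertices induce a P5 or an HVN;
  the instances listed cover these traces.\<close>

lemma classification: "far x \<or> K x \<or> Z x \<or> X x \<or> R x \<or> A3 x \<or> A4 x \<or> B3 x \<or> B4 x"
  using P5_free[of v1 v2 v3 v4 x] P5_free[of v1 v5 v4 v3 x] P5_free[of v3 v4 x v1 w]
    P5_free[of v4 v3 x v1 w] P5_free[of v2 v3 v4 v5 x] P5_free[of v5 v4 v3 v2 x]
    P5_free[of v1 w x v3 v4] P5_free[of v1 w x v4 v3] HVN_free[of v2 x v1 w v3]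
    P5_free[of v2 v1 v5 v4 x] P5_free[of v3 v4 v5 v1 x] P5_free[of v3 v4 v5 w x]
    HVN_free[of v5 x v1 w v4]
  by (simp add: class_defs adj_commute) argo

text \<open>Adjacent \<open>x\<close> and \<open>y\<close> form a K4 with \<open>v1\<close> and
  \<open>w\<close>. If \<open>v2\<close> sees neither, it completes an HVN; if it sees one of them,
  that one misses \<open>v5\<close>, and \<open>v5\<close> completes an HVN on the K4 it forms with
  \<open>v1\<close>, \<open>w\<close>, \<open>v2\<close>.\<close>

lemma K_stable: "K x \<Longrightarrow> K y \<Longrightarrow> \<not> x \<sim> y"
  using HVN_free[of v1 w x y v2] HVN_free[of v1 w v2 x v5] HVN_free[of v1 w v2 y v5]
  by (simp add: class_defs adj_commute) argo

text \<open>Adjacent \<open>x\<close> and \<open>y\<close> form a K4 with \<open>v3\<close> and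
  \<open>v4\<close>. A common neighbour \<open>v1\<close> or \<open>w\<close> would give an HVN, so
  one end sees \<open>v1\<close> and the other \<open>w\<close>. The end at \<open>w\<close> sees
  \<open>v2\<close> or \<open>v5\<close>; this vertex gives an HVN whether or not it also sees the
  other end.\<close>

lemma Z_stable: "Z x \<Longrightarrow> Z y \<Longrightarrow> \<not> x \<sim> y"
  using HVN_free[of v3 x v4 y v2] HVN_free[of v3 y v4 x v2] HVN_free[of v4 x v3 y v5]
    HVN_free[of v4 y v3 x v5] HVN_free[of x y v2 v3 v5] HVN_free[of x y v3 v4 v1]
    HVN_free[of x y v3 v4 w] P5_free[of v2 v1 v5 v4 x] P5_free[of v2 v1 v5 v4 y]
    HVN_free[of v2 x v3 y v1] HVN_free[of v2 x v3 y w] HVN_free[of v5 x v4 y v1]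
    HVN_free[of v5 x v4 y w]
  by (simp add: class_defs adj_commute) argo

text \<open>If \<open>x\<close> and \<open>y\<close> are non-adjacent, the edge \<open>v1 w\<close>
  extends through \<open>x\<close> and then \<open>v3\<close> or \<open>v4\<close> to
  \<open>y\<close>, an induced P5. The other instances treat adjacent \<open>x\<close> and
  \<open>y\<close>.\<close>

lemma Z_excludes_X: "Z x \<Longrightarrow> \<not> X y"
  using P5_free[of v1 w x v3 y] P5_free[of w v1 x v3 y] P5_free[of v2 v1 v5 v4 x]
    P5_free[of v2 w v5 v4 x] HVN_free[of v2 x v3 y v1] HVN_free[of v2 x v3 y w]
    HVN_free[of v4 x v5 y v3] P5_free[of v1 w x v4 y] P5_free[of w v1 x v4 y]
    HVN_free[of v3 y v4 x v2] P5_free[of v1 v2 y x v4] P5_free[of v1 v5 y x v3]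
    P5_free[of v3 x y v5 w] P5_free[of v4 x y v2 w]
  by (simp add: class_defs adj_commute) argo

text \<open>Non-adjacent \<open>x\<close> and \<open>y\<close> end in the same P5 through
  \<open>v3\<close>. Otherwise \<open>x\<close>, \<open>y\<close>, \<open>v3\<close>,
  \<open>v4\<close> form a K4, so \<open>v2\<close> must see \<open>x\<close> too; then
  \<open>v1\<close> or \<open>w\<close> completes an HVN on \<open>v2\<close>, \<open>x\<close>,
  \<open>v3\<close>, \<open>y\<close>.\<close>

lemma Z_excludes_B3: "Z x \<Longrightarrow> \<not> B3 y"
  using P5_free[of v1 w x v3 y] HVN_free[of v3 y v4 x v2] P5_free[of w v1 x v3 y]
    HVN_free[of v2 x v3 y v1] HVN_free[of v2 x v3 y w]
  by (simp add: class_defs adj_commute) argo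

lemma B3_B4: "B3 x \<Longrightarrow> B4 y \<Longrightarrow> \<not> x \<sim> y"
  using HVN_free[of v3 x v4 y v2] by (auto simp: class_defs adj_commute)

text \<open>An edge gives a P5 if \<open>y\<close> misses \<open>v1\<close>, another if
  \<open>y\<close> sees \<open>v1\<close> but not \<open>w\<close>, and an HVN on the K4
  \<open>v2\<close>, \<open>y\<close>, \<open>v1\<close>, \<open>w\<close> if it sees both.\<close>

lemma B3_R: "B3 x \<Longrightarrow> R y \<Longrightarrow> \<not> x \<sim> y"
  using P5_free[of v1 v5 y x v3] HVN_free[of v2 y v1 w x] P5_free[of v3 x y v1 w]
  by (simp add: class_defs adj_commute) argo

text \<open>Together with its reflection this empties \<open>X\<close> as soon as \<open>B3\<close>
  and \<open>B4\<close> are both nonempty.\<close>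

lemma B3_X: "B3 x \<Longrightarrow> X y \<Longrightarrow> \<not> y \<sim> v3"
  using P5_free[of v1 v5 y v3 x] HVN_free[of v3 x v2 y v4] HVN_free[of v4 y v3 x v5]
  by (simp add: class_defs adj_commute) argo

text \<open>An edge forms a K4 with \<open>v2\<close>, \<open>v3\<close> or with \<open>v4\<close>,
  \<open>v5\<close>, which \<open>v5\<close> or \<open>v2\<close> completes to an HVN. So
  \<open>X\<close> splits into two stable sets according to \<open>v3\<close>.\<close>

lemma X_stable: "X x \<Longrightarrow> X y \<Longrightarrow> (x \<sim> v3) = (y \<sim> v3) \<Longrightarrow> \<not> x \<sim> y"
  using HVN_free[of x y v2 v3 v5] HVN_free[of x y v4 v5 v2]
  by (simp add: class_defs adj_commute) argo

text \<open>A path of three wheel vertices ending at a neighbour of \<open>x\<close> extends by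
  \<open>x\<close> and \<open>y\<close> to an induced P5. With the reflection, only
  \<open>K\<close>, \<open>Z\<close> and \<open>X\<close> can border the far vertices.\<close>

lemma far_left: "far y \<Longrightarrow> R x \<or> A3 x \<or> B3 x \<Longrightarrow> \<not> x \<sim> y"
  using P5_free[of v3 v4 v5 x y] P5_free[of v1 v5 v4 x y]
  by (simp add: class_defs adj_commute) argo

lemma A3_A4: "A3 x \<Longrightarrow> A4 y \<Longrightarrow> x \<sim> y"
  using P5_free[of v2 x v4 v5 y]
  by (simp add: class_defs adj_commute) argo

lemma A3_B4: "A3 x \<Longrightarrow> B4 y \<Longrightarrow> x \<sim> y"
  using P5_free[of v1 v2 x v4 y]
  by (simp add: class_defs adj_commute) argo

text \<open>\<open>A3\<close> and \<open>A4\<close> are completely joined, so an edge in each gives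
  a K4, and \<open>v2\<close> sees only its \<open>A3\<close> end. Hence one of the two classes is
  stable.\<close>

lemma A3_A4_edges:
  assumes "A3 x" "A3 x'" "x \<sim> x'" "A4 y" "A4 y'"
  shows "\<not> y \<sim> y'"
  using HVN_free[of x x' y y' v2] assms A3_A4[of x y] A3_A4[of x' y] A3_A4[of x y'] A3_A4[of x' y']
  by (auto simp: A3_def A4_def adj_commute)

lemma A3_B4_edges:
  assumes "A3 x" "A3 x'" "x \<sim> x'" "B4 y" "B4 y'"
  shows "\<not> y \<sim> y'"
  using HVN_free[of x x' y y' v2] assms A3_B4[of x y] A3_B4[of x' y] A3_B4[of x y'] A3_B4[of x' y']
  by (auto simp: A3_def B4_def adj_commute)

text \<open>These are the reflections of \<open>B3_R\<close>, \<open>B3_X\<close>,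
  \<open>Z_excludes_B3\<close>, \<open>far_left\<close> and \<open>A3_B4_edges\<close>.\<close>

lemma B4_R: "B4 x \<Longrightarrow> R y \<Longrightarrow> \<not> x \<sim> y"
  and B4_X: "B4 x \<Longrightarrow> X y \<Longrightarrow> \<not> y \<sim> v4"
  and Z_excludes_B4: "Z x \<Longrightarrow> \<not> B4 y"
  and far_right: "far y \<Longrightarrow> A4 x \<or> B4 x \<Longrightarrow> \<not> x \<sim> y"
  and A4_B3_edges: "A4 x \<Longrightarrow> A4 x' \<Longrightarrow> x \<sim> x' \<Longrightarrow> B3 y \<Longrightarrow> B3 y' \<Longrightarrow> \<not> y \<sim> y'"
proof -
  interpret m: T5_wheel V adj v1 v5 v4 v3 v2 w by (rule mirror)
  have [simp]: "m.B3 = B4" "m.B4 = B3" "m.A3 = A4" "m.R = R" "m.X = X" "m.Z = Z" "m.far = far"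
    unfolding m.class_defs class_defs by (intro ext; blast)+
  show "B4 x \<Longrightarrow> R y \<Longrightarrow> \<not> x \<sim> y" "B4 x \<Longrightarrow> X y \<Longrightarrow> \<not> y \<sim> v4" "Z x \<Longrightarrow> \<not> B4 y"
    "far y \<Longrightarrow> A4 x \<or> B4 x \<Longrightarrow> \<not> x \<sim> y"
    "A4 x \<Longrightarrow> A4 x' \<Longrightarrow> x \<sim> x' \<Longrightarrow> B3 y \<Longrightarrow> B3 y' \<Longrightarrow> \<not> y \<sim> y'"
    using m.B3_R[of x y] m.B3_X[of x y] m.Z_excludes_B3[of x y] m.far_left[of y x]
      m.A3_B4_edges[of x x' y y'] by simp_all
qed

text \<open>Otherwise \<open>q\<close>, \<open>p\<close>, \<open>z\<close> and two adjacent wheel vertices, just one of which sees \<open>z\<close>, form an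
  induced \<open>P\<^sub>5\<close>; no vertex sees the whole wheel.\<close>

lemma far_homogeneous:
  assumes "far p" "far q" "p \<sim> q" "z \<sim> p" "\<not> far z"
  shows "z \<sim> q"
  using assms HVN_free[of z v2 v1 w v3]
    P5_free[of q p z v1 v2] P5_free[of q p z v2 v1] P5_free[of q p z v2 v3] P5_free[of q p z v3 v2]
    P5_free[of q p z v3 v4] P5_free[of q p z v4 v3] P5_free[of q p z v4 v5] P5_free[of q p z v5 v4]
    P5_free[of q p z v5 v1] P5_free[of q p z v1 v5] P5_free[of q p z v5 w] P5_free[of q p z w v5]
    P5_free[of q p z v1 w] P5_free[of q p z w v1] P5_free[of q p z w v2] P5_free[of q p z v2 w]
  by (simp add: far_def adj_commute) argo

end

subsection \<open>Colouring around a T-5-wheel\<close>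

locale bounded_T5_wheel = T5_wheel +
  fixes k :: nat
  assumes connected_V: "connected_set V"
    and k3: "3 \<le> k"
    and clique_le: "S \<subseteq> V \<Longrightarrow> clique S \<Longrightarrow> card S \<le> k"
begin

text \<open>Each component of the far vertices lies in the neighbourhood of one vertex
  \<open>z\<close> that is not far, by \<open>far_homogeneous\<close>. The palette \<open>C\<close>
  stays open because one use shifts it.\<close>

lemma far_colouring:
  assumes "finite C" "card C = k"
  shows "\<exists>c. colouring {y \<in> V. far y} C c"
proof -
  let ?Y = "{y \<in> V. far y}"
  have "\<exists>c. colouring (component ?Y y) C c \<and> c ` (component ?Y y \<inter> {}) \<subseteq> {}" if y: "y \<in> ?Y" for y
  proof -
    let ?Q = "component ?Y y"
    have QY: "?Q \<subseteq> ?Y" using y by (rule component_subset)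
    have "\<exists>z x. x \<in> ?Q \<and> z \<sim> x \<and> \<not> far z"
    proof (rule ccontr)
      \<comment> \<open>Were no such \<open>z\<close> available, connectivity would make
        \<open>?Q\<close> all of \<open>V\<close>, so that \<open>v1\<close> would be far.\<close>
      assume none: "\<not> ?thesis"
      have "y \<in> V" using y by simp
      have "q \<in> ?Q" if "q \<in> V" for q
        using connected_V \<open>y \<in> V\<close> that
      proof (induction rule: connected_set_induct)
        case base
        show ?case by (rule component_self)
      next
        case (step p q)
        have "far q" using none step.IH adj_sym[OF step.hyps(3)] by blast
        moreover have "p \<in> ?Y" using step.IH QY by blast
        ultimately show ?case
          using component_step[OF step.IH _ _ step.hyps(3)] step.hyps(2) by blast
      qed
      moreover have "v1 \<in> V" using adj_in_V[of v1 v2] by simp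
      ultimately have "far v1" using QY by blast
      then show False by (simp add: far_def)
    qed
    then obtain z x where zx: "x \<in> ?Q" "z \<sim> x" "\<not> far z" by blast
    have "z \<sim> q" if "q \<in> ?Q" for q
      using connected_component[OF y] zx(1) that
    proof (induction rule: connected_set_induct)
      case base
      show ?case by (rule zx(2))
    next
      case (step p q)
      then show ?case using far_homogeneous[of p q z] zx(3) QY by blast
    qed
    then obtain c where "colouring ?Q C c"
      using neighbourhood_colouring[of ?Q z C] assms k3 clique_le by metis
    then show ?thesis by auto
  qed
  then show ?thesis using colouring_by_components[of ?Y C "{}" "{}"] by blast
qed

section \<open>The three colourings with \<open>k + 3\<close> colours\<close>

lemma nbr_colouring: "\<exists>c. colouring {x. v \<sim> x} {..<k} c"
  by (rule neighbourhood_colouring[of _ v]) (use k3 clique_le in auto)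

lemma colouringD: "colouring S C c \<Longrightarrow> x \<in> S \<Longrightarrow> c x \<in> C"
  "colouring S C c \<Longrightarrow> x \<in> S \<Longrightarrow> y \<in> S \<Longrightarrow> x \<sim> y \<Longrightarrow> c x \<noteq> c y"
  by (auto simp: colouring_def)

lemma colouring_symI:
  assumes "\<And>x. x \<in> S \<Longrightarrow> c x \<in> C"
    and "\<And>x y. x \<in> S \<Longrightarrow> y \<in> S \<Longrightarrow> x \<sim> y \<Longrightarrow> P x \<Longrightarrow> c x \<noteq> c y"
    and "\<And>x y. x \<in> S \<Longrightarrow> y \<in> S \<Longrightarrow> x \<sim> y \<Longrightarrow> \<not> P x \<Longrightarrow> \<not> P y \<Longrightarrow> c x \<noteq> c y"
  shows "colouring S C c"
  unfolding colouring_def using assms adj_sym by (metis image_subsetI)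

text \<open>With \<open>X\<close>, \<open>B3\<close> and \<open>B4\<close> empty, the far vertices
  border only \<open>K\<close> and \<open>Z\<close>, which have colours of their own, so they can
  reuse the \<open>k\<close> colours of the neighbourhood of \<open>v2\<close>. Of the rest, only
  \<open>A4\<close> misses \<open>v2\<close>; it takes colour \<open>k\<close>.\<close>

lemma colouring_Z:
  assumes "Z z" and A4: "\<And>x y. A4 x \<Longrightarrow> A4 y \<Longrightarrow> \<not> x \<sim> y"
  shows "\<exists>c. colouring V {..<k + 3} c"
proof -
  obtain f where f: "colouring {y \<in> V. far y} {..<k} f"
    using far_colouring[of "{..<k}"] by auto
  obtain h where h: "colouring {x. v2 \<sim> x} {..<k} h" using nbr_colouring by blast
  have rest: "far x \<or> K x \<or> Z x \<or> R x \<or> A3 x \<or> A4 x" for x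
    using classification[of x] Z_excludes_X Z_excludes_B3 Z_excludes_B4 \<open>Z z\<close> by blast
  have far_only: "K y \<or> Z y" if "far x" "\<not> far y" "x \<sim> y" for x y
    using rest[of y] far_left[OF that(1), of y] far_right[OF that(1), of y] that adj_sym by blast
  define c where "c x = (if far x then f x else if K x then k + 2 else if Z x then k + 1
    else if x \<sim> v2 then h x else k)" for x
  have fk: "f x < k" if "x \<in> V" "far x" for x using colouringD(1)[OF f] that by simp
  have hk: "h x < k" if "x \<sim> v2" for x using colouringD(1)[OF h] that adj_sym by simp
  have h_ne: "h x \<noteq> h y" if "x \<sim> v2" "y \<sim> v2" "x \<sim> y" for x y
    using colouringD(2)[OF h, of x y] that adj_sym by simp
  have A4x: "A4 x" if "\<not> far x" "\<not> K x" "\<not> Z x" "\<not> x \<sim> v2" for x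
    using rest[of x] that by (auto simp: R_def A3_def)
  have near: "K x \<and> c x = k + 2 \<or> Z x \<and> c x = k + 1 \<or> A4 x \<and> c x = k
    \<or> x \<sim> v2 \<and> c x = h x \<and> h x < k" if "\<not> far x" for x
    using A4x[of x] hk[of x] that by (simp add: c_def)
  have "colouring V {..<k + 3} c"
  proof (rule colouring_symI[where P = far])
    fix x assume "x \<in> V"
    then show "c x \<in> {..<k + 3}" using fk[of x] hk[of x] by (auto simp: c_def)
  next
    fix x y assume xy: "x \<in> V" "y \<in> V" "x \<sim> y" "far x"
    then show "c x \<noteq> c y"
      using far_only[of x y] colouringD(2)[OF f, of x y] fk[of x] by (auto simp: c_def)
  next
    fix x y assume xy: "x \<in> V" "y \<in> V" "x \<sim> y" "\<not> far x" "\<not> far y"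
    show "c x \<noteq> c y"
      using near[OF xy(4)] near[OF xy(5)] xy(3) K_stable[of x y] Z_stable[of x y] A4[of x y] h_ne[of x y]
      by - (elim disjE conjE; auto)
  qed
  then show ?thesis by blast
qed

text \<open>Here \<open>X\<close> borders the far vertices and is coloured along with the
  neighbourhood of \<open>v2\<close>; it is confined to the colours 0 and 1.\<close>

lemma colouring_no_Z:
  assumes no_Z: "\<And>x. \<not> Z x"
    and A4: "\<And>x y. A4 x \<Longrightarrow> A4 y \<Longrightarrow> \<not> x \<sim> y" and B4: "\<And>x y. B4 x \<Longrightarrow> B4 y \<Longrightarrow> \<not> x \<sim> y"
  shows "\<exists>c. colouring V {..<k + 3} c"
proof -
  \<comment> \<open>The shifted palette avoids 0 and 1, used on \<open>X\<close>, and
    \<open>k + 2\<close>, used on \<open>K\<close>. Clashes with \<open>k\<close> and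
    \<open>k + 1\<close> are harmless, as no edge joins far vertices to \<open>A4\<close> or
    \<open>B4\<close>.\<close>
  obtain f where f: "colouring {y \<in> V. far y} {2..<k + 2} f"
    using far_colouring[of "{2..<k + 2}"] by auto
  \<comment> \<open>The neighbour \<open>v3\<close> of \<open>v2\<close> is the base vertex:
    \<open>?I\<close> sees it, \<open>?J\<close> does not.\<close>
  let ?I = "{x. X x \<and> x \<sim> v3}" and ?J = "{x. X x \<and> \<not> x \<sim> v3}"
  have "stable ?I" "stable ?J" using X_stable by (auto simp: stable_def)
  then have "\<exists>c. colouring {x. v2 \<sim> x} {..<k} c \<and> c ` ({x. v2 \<sim> x} \<inter> (?I \<union> ?J)) \<subseteq> {0, 1}"
    by (intro neighbourhood_colouring_two_coloured[of _ v2 _ _ _ v3]) (use k3 clique_le in auto)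
  then obtain h where h: "colouring {x. v2 \<sim> x} {..<k} h"
    and h01: "h ` ({x. v2 \<sim> x} \<inter> (?I \<union> ?J)) \<subseteq> {0, 1}" by blast
  have X01: "h x < 2" if "X x" for x
  proof -
    have "h x \<in> {0, 1}" using h01 that adj_commute[of v2 x] unfolding X_def by blast
    then show ?thesis by auto
  qed
  have far_only: "K y \<or> X y" if "far x" "\<not> far y" "x \<sim> y" for x y
    using classification[of y] no_Z far_left[OF that(1), of y] far_right[OF that(1), of y] that adj_sym
    by blast
  define c where "c x = (if far x then f x else if K x then k + 2
    else if x \<sim> v2 then h x else if A4 x then k else k + 1)" for x
  have fk: "2 \<le> f x \<and> f x < k + 2" if "x \<in> V" "far x" for x using colouringD(1)[OF f] that by simp
  have hk: "h x < k" if "x \<sim> v2" for x using colouringD(1)[OF h] that adj_sym by simp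
  have h_ne: "h x \<noteq> h y" if "x \<sim> v2" "y \<sim> v2" "x \<sim> y" for x y
    using colouringD(2)[OF h, of x y] that adj_sym by simp
  have B4x: "B4 x" if "\<not> far x" "\<not> K x" "\<not> A4 x" "\<not> x \<sim> v2" for x
    using classification[of x] no_Z that by (auto simp: R_def A3_def B3_def X_def)
  have near: "K x \<and> c x = k + 2 \<or> B4 x \<and> c x = k + 1 \<or> A4 x \<and> c x = k
    \<or> x \<sim> v2 \<and> c x = h x \<and> h x < k" if "\<not> far x" for x
    using B4x[of x] hk[of x] that by (simp add: c_def)
  have "colouring V {..<k + 3} c"
  proof (rule colouring_symI[where P = far])
    fix x assume "x \<in> V"
    then show "c x \<in> {..<k + 3}" using fk[of x] hk[of x] by (auto simp: c_def)
  next
    fix x y assume xy: "x \<in> V" "y \<in> V" "x \<sim> y" "far x"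
    then show "c x \<noteq> c y"
      using far_only[of x y] colouringD(2)[OF f, of x y] fk[of x] X01[of y]
      by (auto simp: c_def X_def)
  next
    fix x y assume xy: "x \<in> V" "y \<in> V" "x \<sim> y" "\<not> far x" "\<not> far y"
    show "c x \<noteq> c y"
      using near[OF xy(4)] near[OF xy(5)] xy(3) K_stable[of x y] A4[of x y] B4[of x y] h_ne[of x y]
      by - (elim disjE conjE; auto)
  qed
  then show ?thesis by blast
qed

text \<open>\<open>X\<close> is empty, and no edge joins \<open>B4\<close> to \<open>R\<close> or
  \<open>B3\<close>. So \<open>R\<close> and \<open>B3\<close>, coloured as neighbours of
  \<open>v2\<close>, can share \<open>k\<close> colours with \<open>B4\<close>, coloured as
  neighbours of \<open>v5\<close>.\<close>

lemma colouring_B3_B4: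
  assumes no_Z: "\<And>x. \<not> Z x" and "B3 b" "B4 b'"
    and A3: "\<And>x y. A3 x \<Longrightarrow> A3 y \<Longrightarrow> \<not> x \<sim> y" and A4: "\<And>x y. A4 x \<Longrightarrow> A4 y \<Longrightarrow> \<not> x \<sim> y"
  shows "\<exists>c. colouring V {..<k + 3} c"
proof -
  obtain f where f: "colouring {y \<in> V. far y} {..<k} f"
    using far_colouring[of "{..<k}"] by auto
  obtain g where g: "colouring {x. v2 \<sim> x} {..<k} g" using nbr_colouring by blast
  obtain h where h: "colouring {x. v5 \<sim> x} {..<k} h" using nbr_colouring by blast
  have "\<not> X x" for x
    using B3_X[OF \<open>B3 b\<close>] B4_X[OF \<open>B4 b'\<close>] unfolding X_def by blast
  then have rest: "far x \<or> K x \<or> R x \<or> A3 x \<or> A4 x \<or> B3 x \<or> B4 x" for x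
    using classification[of x] no_Z by blast
  have far_only: "K y" if "far x" "\<not> far y" "x \<sim> y" for x y
    using rest[of y] far_left[OF that(1), of y] far_right[OF that(1), of y] that adj_sym by blast
  \<comment> \<open>\<open>A3\<close> also sees \<open>v2\<close> but is tested first: it is
    completely joined to \<open>B4\<close>, so it needs its own colour.\<close>
  define c where "c x = (if far x then f x else if K x then k + 2 else if A3 x then k
    else if A4 x then k + 1 else if x \<sim> v2 then g x else h x)" for x
  have fk: "f x < k" if "x \<in> V" "far x" for x using colouringD(1)[OF f] that by simp
  have gk: "g x < k" if "x \<sim> v2" for x using colouringD(1)[OF g] that adj_sym by simp
  have hk: "h x < k" if "x \<sim> v5" for x using colouringD(1)[OF h] that adj_sym by simp
  have RB3: "R x \<or> B3 x" if "\<not> far x" "\<not> K x" "\<not> A3 x" "\<not> A4 x" "x \<sim> v2" for x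
    using rest[of x] that by (auto simp: B4_def)
  have B4x: "B4 x" "x \<sim> v5" if "\<not> far x" "\<not> K x" "\<not> A3 x" "\<not> A4 x" "\<not> x \<sim> v2" for x
    using rest[of x] that by (auto simp: R_def B3_def B4_def)
  have apart: "\<not> x \<sim> y" if "R x \<or> B3 x" "B4 y" for x y
    using that B3_B4 B4_R adj_sym by blast
  have "colouring V {..<k + 3} c"
  proof (rule colouring_symI[where P = far])
    fix x assume "x \<in> V"
    then show "c x \<in> {..<k + 3}" using fk[of x] gk[of x] hk[of x] B4x[of x] by (auto simp: c_def)
  next
    fix x y assume xy: "x \<in> V" "y \<in> V" "x \<sim> y" "far x"
    then show "c x \<noteq> c y"
      using far_only[of x y] colouringD(2)[OF f, of x y] fk[of x] by (auto simp: c_def)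
  next
    fix x y assume xy: "x \<in> V" "y \<in> V" "x \<sim> y" "\<not> far x" "\<not> far y"
    then show "c x \<noteq> c y"
      using K_stable[of x y] A3[of x y] A4[of x y] RB3[of x] RB3[of y] B4x[of x] B4x[of y]
        apart[of x y] apart[of y x] gk[of x] gk[of y] hk[of x] hk[of y]
        colouringD(2)[OF g, of x y] colouringD(2)[OF h, of x y] adj_commute[of v2] adj_commute[of v5]
        adj_sym[of x y]
      by (auto simp: c_def)
  qed
  then show ?thesis by blast
qed

lemma ex_colouring: "\<exists>c. colouring V {..<k + 3} c"
proof -
  interpret m: T5_wheel V adj v1 v5 v4 v3 v2 w by (rule mirror)
  interpret m: bounded_T5_wheel V adj v1 v5 v4 v3 v2 w k
    by unfold_locales (fact connected_V k3 clique_le)+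
  have [simp]: "m.B4 = B3" "m.A4 = A3" "m.Z = Z"
    unfolding m.class_defs class_defs by (intro ext; blast)+
  define st where "st P \<longleftrightarrow> (\<forall>x y. P x \<longrightarrow> P y \<longrightarrow> \<not> x \<sim> y)" for P
  have A34: "st A3 \<or> st A4" and A3B4: "st A3 \<or> st B4" and A4B3: "st A4 \<or> st B3"
    using A3_A4_edges A3_B4_edges A4_B3_edges unfolding st_def by blast+
  show ?thesis
  proof (cases "\<exists>z. Z z")
    case True
    then show ?thesis using colouring_Z m.colouring_Z A34 unfolding st_def by auto
  next
    case False
    \<comment> \<open>If \<open>A3\<close> or \<open>A4\<close> is not stable, the dichotomies give
      the first or second case. If both are stable and those cases fail, neither \<open>B3\<close>
      nor \<open>B4\<close> is stable, so both are nonempty.\<close>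
    consider "st A4" "st B4" | "st A3" "st B3" | "st A3" "st A4" "\<exists>b. B3 b" "\<exists>b. B4 b"
      using A34 A3B4 A4B3 unfolding st_def by blast
    then show ?thesis
    proof cases
      case 1
      then show ?thesis using colouring_no_Z False unfolding st_def by blast
    next
      case 2
      then show ?thesis using m.colouring_no_Z False unfolding st_def by simp
    next
      case 3
      then show ?thesis using colouring_B3_B4 False unfolding st_def by blast
    qed
  qed
qed

end

subsection \<open>Induced copies of small graphs\<close>

lemma graph_of_edges_simps [simp]:
  "verts (graph_of_edges n E) = {..<n}" "arcs (graph_of_edges n E) = E \<union> E\<inverse>"
  "tail (graph_of_edges n E) = fst" "head (graph_of_edges n E) = snd"
  by (auto simp: graph_of_edges_def)

lemma dominates_graph_of_edges [simp]:
  "u \<rightarrow>\<^bsub>graph_of_edges n E\<^esub> v \<longleftrightarrow> (u, v) \<in> E \<union> E\<inverse>"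
  by (force simp: arcs_ends_conv)

lemma contains_inducedE:
  assumes "contains_induced G H"
  obtains f where "\<And>u v. u \<in> verts H \<Longrightarrow> v \<in> verts H \<Longrightarrow> f u \<rightarrow>\<^bsub>G\<^esub> f v \<longleftrightarrow> u \<rightarrow>\<^bsub>H\<^esub> v"
proof -
  obtain g where ind: "induced_subgraph (app_iso g H) G"
    and iso: "pre_digraph.digraph_isomorphism H g"
    using assms by (auto simp: contains_induced_def digraph_iso_def)
  let ?f = "iso_verts g"
  have wf: "wf_digraph H" and inj: "inj_on ?f (verts H)"
    and ends: "\<And>e. e \<in> arcs H \<Longrightarrow> iso_tail g (iso_arcs g e) = ?f (tail H e)
      \<and> iso_head g (iso_arcs g e) = ?f (head H e)"
    using iso by (auto simp: pre_digraph.digraph_isomorphism_def)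
  \<comment> \<open>Being induced means that the image contains every arc of \<open>G\<close>
    between image vertices, with the ends it has in \<open>G\<close>.\<close>
  have sub: "iso_arcs g ` arcs H = {e \<in> arcs G. tail G e \<in> ?f ` verts H \<and> head G e \<in> ?f ` verts H}"
    and tl: "\<And>e. e \<in> iso_arcs g ` arcs H \<Longrightarrow> tail G e = iso_tail g e \<and> head G e = iso_head g e"
    using ind by (auto simp: induced_subgraph_def subgraph_def compatible_def)
  have "?f u \<rightarrow>\<^bsub>G\<^esub> ?f v \<longleftrightarrow> u \<rightarrow>\<^bsub>H\<^esub> v" if "u \<in> verts H" "v \<in> verts H" for u v
  proof
    assume "?f u \<rightarrow>\<^bsub>G\<^esub> ?f v"
    then obtain e where e: "e \<in> arcs G" "tail G e = ?f u" "head G e = ?f v" by (rule reachableE)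
    then have "e \<in> iso_arcs g ` arcs H" using sub that by auto
    then obtain e' where e': "e' \<in> arcs H" "e = iso_arcs g e'" by blast
    then have "?f (tail H e') = ?f u" "?f (head H e') = ?f v" using ends tl e by auto
    then have "tail H e' = u" "head H e' = v"
      using inj that e'(1) wf by (auto simp: inj_on_def wf_digraph_def)
    then show "u \<rightarrow>\<^bsub>H\<^esub> v" using e'(1) by (auto simp: arcs_ends_conv)
  next
    assume "u \<rightarrow>\<^bsub>H\<^esub> v"
    then obtain e where e: "e \<in> arcs H" "tail H e = u" "head H e = v" by (rule reachableE)
    then have "iso_arcs g e \<in> arcs G" "tail G (iso_arcs g e) = ?f u" "head G (iso_arcs g e) = ?f v"
      using sub tl[OF imageI[OF e(1)]] ends[OF e(1)] by auto
    then show "?f u \<rightarrow>\<^bsub>G\<^esub> ?f v" by (force simp: arcs_ends_conv)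
  qed
  then show ?thesis by (rule that)
qed

text \<open>A choice of one arc of \<open>G\<close> for each pair in the edge relation is the arc
  part of the isomorphism; it hits every arc of the induced subgraph because there are no parallel
  arcs.\<close>

lemma contains_induced_graph_of_edgesI:
  assumes "graph G" and E: "E \<subseteq> {..<n} \<times> {..<n}"
    and inj: "inj_on f {..<n}" and f: "f ` {..<n} \<subseteq> verts G"
    and adj: "\<And>i j. i < n \<Longrightarrow> j < n \<Longrightarrow> f i \<rightarrow>\<^bsub>G\<^esub> f j \<longleftrightarrow> (i, j) \<in> E \<union> E\<inverse>"
  shows "contains_induced G (graph_of_edges n E)"
proof -
  interpret graph G by fact
  let ?H = "graph_of_edges n E"
  have "\<exists>e. e \<in> arcs G \<and> tail G e = f (fst p) \<and> head G e = f (snd p)" if "p \<in> E \<union> E\<inverse>" for p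
  proof -
    have "fst p < n" "snd p < n" using that E by auto
    then have "f (fst p) \<rightarrow>\<^bsub>G\<^esub> f (snd p)" using adj[of "fst p" "snd p"] that by (cases p) simp
    then show ?thesis by (auto simp: arcs_ends_conv)
  qed
  then obtain h where h: "\<And>p. p \<in> E \<union> E\<inverse> \<Longrightarrow>
      h p \<in> arcs G \<and> tail G (h p) = f (fst p) \<and> head G (h p) = f (snd p)"
    by metis
  \<comment> \<open>Taking \<open>head\<close> and \<open>tail\<close> from \<open>G\<close> itself
    makes the image literally equal to the induced subgraph.\<close>
  define g where "g = \<lparr>iso_verts = f, iso_arcs = h, iso_head = head G, iso_tail = tail G\<rparr>"
  have arcs_image: "h ` (E \<union> E\<inverse>) = {e \<in> arcs G. tail G e \<in> f ` {..<n} \<and> head G e \<in> f ` {..<n}}"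
  proof (intro subset_antisym subsetI)
    fix e assume "e \<in> h ` (E \<union> E\<inverse>)"
    then show "e \<in> {e \<in> arcs G. tail G e \<in> f ` {..<n} \<and> head G e \<in> f ` {..<n}}"
      using h E by fastforce
  next
    fix e assume "e \<in> {e \<in> arcs G. tail G e \<in> f ` {..<n} \<and> head G e \<in> f ` {..<n}}"
    then obtain i j where e: "e \<in> arcs G" "i < n" "j < n" "tail G e = f i" "head G e = f j" by auto
    then have ij: "(i, j) \<in> E \<union> E\<inverse>"
      using adj[of i j] by (force simp: arcs_ends_conv)
    then have "arc_to_ends G e = arc_to_ends G (h (i, j))"
      using h e by (simp add: arc_to_ends_def)
    then have "e = h (i, j)" using no_multi_arcs e h[OF ij] by blast
    then show "e \<in> h ` (E \<union> E\<inverse>)" using ij by blast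
  qed
  have "inj_on h (E \<union> E\<inverse>)"
  proof (rule inj_onI)
    fix p q assume pq: "p \<in> E \<union> E\<inverse>" "q \<in> E \<union> E\<inverse>" "h p = h q"
    then have "f (fst p) = f (fst q)" "f (snd p) = f (snd q)" using h by metis+
    moreover have "fst p < n" "snd p < n" "fst q < n" "snd q < n" using pq E by auto
    ultimately show "p = q" using inj by (auto simp: inj_on_def prod_eq_iff)
  qed
  moreover have "wf_digraph ?H" using E by unfold_locales auto
  ultimately have iso: "pre_digraph.digraph_isomorphism ?H g"
    using inj h by (auto simp: pre_digraph.digraph_isomorphism_def g_def)
  have "app_iso g ?H = G \<restriction> (f ` {..<n})"
    using arcs_image by (simp add: app_iso_def induce_subgraph_def g_def)
  moreover have "induced_subgraph (G \<restriction> (f ` {..<n})) G"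
    using f by (rule induced_induce)
  ultimately show ?thesis
    unfolding contains_induced_def digraph_iso_def using iso by metis
qed

lemma contains_induced_graph_of_edges_5I:
  assumes "graph G" and E: "E \<subseteq> {..<5} \<times> {..<5}"
    and "distinct [a, b, c, d, e]" and "{a, b, c, d, e} \<subseteq> verts G"
    and adj: "\<And>i j. i < 5 \<Longrightarrow> j < 5 \<Longrightarrow>
      [a, b, c, d, e] ! i \<rightarrow>\<^bsub>G\<^esub> [a, b, c, d, e] ! j \<longleftrightarrow> (i, j) \<in> E \<union> E\<inverse>"
  shows "contains_induced G (graph_of_edges 5 E)"
proof (rule contains_induced_graph_of_edgesI[where f = "(!) [a, b, c, d, e]"])
  show "inj_on ((!) [a, b, c, d, e]) {..<5}" using assms(3) by (intro inj_on_nth) auto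
  show "(!) [a, b, c, d, e] ` {..<5} \<subseteq> verts G"
    using assms(4) by (auto simp: less_Suc_eq numeral_eq_Suc)
qed (use assms in auto)

lemma P5_HVN_free_graph:
  assumes "graph G" "\<not> contains_induced G P5" "\<not> contains_induced G HVN"
  shows "P5_HVN_free (verts G) (\<lambda>x y. x \<rightarrow>\<^bsub>G\<^esub> y)"
proof -
  interpret graph G by fact
  have dominates_sym: "y \<rightarrow>\<^bsub>G\<^esub> x" if "x \<rightarrow>\<^bsub>G\<^esub> y" for x y
    using that sym_arcs by (rule arcs_ends_symmetric[rotated])
  have dominates_irrefl: "\<not> x \<rightarrow>\<^bsub>G\<^esub> x" for x using adj_not_same by blast
  have non_sym: "\<not> y \<rightarrow>\<^bsub>G\<^esub> x" if "\<not> x \<rightarrow>\<^bsub>G\<^esub> y" for x y using that dominates_sym by blast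
  show ?thesis
  proof
    show "finite (verts G)" by simp
    show "x \<in> verts G" if "x \<rightarrow>\<^bsub>G\<^esub> y" for x y using that by (rule adj_in_verts)
    show "y \<rightarrow>\<^bsub>G\<^esub> x" if "x \<rightarrow>\<^bsub>G\<^esub> y" for x y using that by (rule dominates_sym)
    show "\<not> x \<rightarrow>\<^bsub>G\<^esub> x" for x by (rule dominates_irrefl)
  next
    fix a b c d e
    assume edges: "a \<rightarrow>\<^bsub>G\<^esub> b" "b \<rightarrow>\<^bsub>G\<^esub> c" "c \<rightarrow>\<^bsub>G\<^esub> d" "d \<rightarrow>\<^bsub>G\<^esub> e"
      and non_edges: "\<not> a \<rightarrow>\<^bsub>G\<^esub> c" "\<not> a \<rightarrow>\<^bsub>G\<^esub> d" "\<not> a \<rightarrow>\<^bsub>G\<^esub> e" "\<not> b \<rightarrow>\<^bsub>G\<^esub> d" "\<not> b \<rightarrow>\<^bsub>G\<^esub> e"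
        "\<not> c \<rightarrow>\<^bsub>G\<^esub> e"
    note adj = edges edges[THEN dominates_sym] non_edges non_edges[THEN non_sym]
      dominates_irrefl
    have "contains_induced G P5"
      unfolding P5_def
    proof (rule contains_induced_graph_of_edges_5I[where a = a and b = b and c = c and d = d and e = e])
      show "distinct [a, b, c, d, e]" using adj by auto
      show "{a, b, c, d, e} \<subseteq> verts G" using edges adj_in_verts by blast
      show "[a, b, c, d, e] ! i \<rightarrow>\<^bsub>G\<^esub> [a, b, c, d, e] ! j
        \<longleftrightarrow> (i, j) \<in> {(0, 1), (1, 2), (2, 3), (3, 4)} \<union> {(0, 1), (1, 2), (2, 3), (3, 4)}\<inverse>"
        if "i < 5" "j < 5" for i j
      proof -
        have "i \<in> {0, 1, 2, 3, 4}" "j \<in> {0, 1, 2, 3, 4}" using that by auto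
        then show ?thesis using adj by (elim insertE emptyE) simp_all
      qed
    qed (use assms in auto)
    then show False using assms by blast
  next
    fix a b c d e
    assume edges: "a \<rightarrow>\<^bsub>G\<^esub> b" "a \<rightarrow>\<^bsub>G\<^esub> c" "a \<rightarrow>\<^bsub>G\<^esub> d" "b \<rightarrow>\<^bsub>G\<^esub> c" "b \<rightarrow>\<^bsub>G\<^esub> d" "c \<rightarrow>\<^bsub>G\<^esub> d"
        "e \<rightarrow>\<^bsub>G\<^esub> a" "e \<rightarrow>\<^bsub>G\<^esub> b"
      and non_edges: "\<not> e \<rightarrow>\<^bsub>G\<^esub> c" "\<not> e \<rightarrow>\<^bsub>G\<^esub> d"
    note adj = edges edges[THEN dominates_sym] non_edges non_edges[THEN non_sym]
      dominates_irrefl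
    have "contains_induced G HVN"
      unfolding HVN_def
    proof (rule contains_induced_graph_of_edges_5I[where a = a and b = b and c = c and d = d and e = e])
      show "distinct [a, b, c, d, e]" using adj by auto
      show "{a, b, c, d, e} \<subseteq> verts G" using edges adj_in_verts by blast
      show "[a, b, c, d, e] ! i \<rightarrow>\<^bsub>G\<^esub> [a, b, c, d, e] ! j
        \<longleftrightarrow> (i, j) \<in> {(0, 1), (0, 2), (0, 3), (1, 2), (1, 3), (2, 3)} \<union> {(4, 0), (4, 1)}
          \<union> ({(0, 1), (0, 2), (0, 3), (1, 2), (1, 3), (2, 3)} \<union> {(4, 0), (4, 1)})\<inverse>"
        if "i < 5" "j < 5" for i j
      proof -
        have "i \<in> {0, 1, 2, 3, 4}" "j \<in> {0, 1, 2, 3, 4}" using that by auto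
        then show ?thesis using adj by (elim insertE emptyE) simp_all
      qed
    qed (use assms in auto)
    then show False using assms by blast
  qed
qed

theorem theorem3p6:
  fixes G :: "('a, 'b) pre_digraph"
  assumes "graph G" and "Digraph_Component.connected G"
    and "\<not> contains_induced G P5" and "\<not> contains_induced G HVN"
    and "contains_induced G T_5_wheel"
  shows "chromatic_number G \<le> clique_number G + 3"
proof -
  interpret graph G by fact
  let ?adj = "\<lambda>x y. x \<rightarrow>\<^bsub>G\<^esub> y"
  let ?k = "clique_number G"
  interpret P5_HVN_free "verts G" ?adj
    by (rule P5_HVN_free_graph[OF assms(1,3,4)])
  have fin: "finite {S. is_clique G S}"
    by (rule finite_subset[of _ "Pow (verts G)"]) (auto simp: is_clique_def)
  have clique_le: "card S \<le> ?k" if "S \<subseteq> verts G" "clique S" for S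
    unfolding clique_number_def
    using finite_imageI[OF fin] by (rule Max_ge) (use that in \<open>auto simp: is_clique_def clique_def\<close>)
  obtain f where f: "\<And>u v. u \<in> verts T_5_wheel \<Longrightarrow> v \<in> verts T_5_wheel \<Longrightarrow>
      ?adj (f u) (f v) \<longleftrightarrow> u \<rightarrow>\<^bsub>T_5_wheel\<^esub> v"
    using contains_inducedE[OF assms(5)] by blast
  interpret T5_wheel "verts G" ?adj "f 0" "f 1" "f 2" "f 3" "f 4" "f 5"
    by unfold_locales (simp_all add: f T_5_wheel_def)
  \<comment> \<open>The triangle \<open>v1\<close>, \<open>v2\<close>, \<open>w\<close> shows that
    the clique number is at least 3.\<close>
  have "f 0 \<noteq> f 1" "f 0 \<noteq> f 5" "f 1 \<noteq> f 5"
    using wheel_edges adj_irrefl by metis+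
  then have "3 = card {f 0, f 1, f 5}" by simp
  also have "\<dots> \<le> ?k"
  proof (rule clique_le)
    show "{f 0, f 1, f 5} \<subseteq> verts G" using wheel_edges adj_in_verts by blast
    show "clique {f 0, f 1, f 5}" by (auto simp: clique_def simp del: One_nat_def)
  qed
  finally have k3: "3 \<le> ?k" .
  have conn: "connected_set (verts G)"
  proof -
    \<comment> \<open>Arcs come in opposite pairs, so connectedness yields directed walks between
      any two vertices.\<close>
    have "strongly_connected G"
      using symmetric_connected_imp_strongly_connected sym_arcs assms(2) by blast
    moreover have "{(x, y). x \<in> verts G \<and> y \<in> verts G \<and> ?adj x y} = arcs_ends G"
      using adj_in_verts by auto
    ultimately show ?thesis
      by (auto simp: connected_set_def links_def strongly_connected_def reachable_conv)
  qed
  interpret bounded_T5_wheel "verts G" ?adj "f 0" "f 1" "f 2" "f 3" "f 4" "f 5" ?k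
    by unfold_locales (fact conn k3 clique_le)+
  obtain c where "colouring (verts G) {..<?k + 3} c" using ex_colouring by blast
  then have "proper_colouring G (?k + 3) c"
    unfolding proper_colouring_def colouring_def using adj_in_verts by auto
  then show ?thesis unfolding chromatic_number_def by (intro Least_le exI)
qed

end
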